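(* Let $(A,+,0,\leq)$ be a preordered monoid with positive cone $P=\{a\in A\mid 0\leq a\}$, and let $\leq_P$ be the relation on $A$ defined by $a\leq_P b$ if and only if $b\in P+a$. Then the monoid operation $+\colon A\times A\to A$ is monotone with respect to $\leq_P$ (that is, $a\leq_P b$ and $c\leq_P d$ imply $a+c\leq_P b+d$ for all $a,b,c,d\in A$) if and only if $P$ is a right normal submonoid of $A$.
   Context: Monoids are written additively but are not assumed commutative. A preordered monoid $(A,+,0,\leq)$ is a monoid $(A,+,0)$ with a preorder (reflexive transitive relation) $\leq$ such that $a\leq b$ and $c\leq d$ imply $a+c\leq b+d$. Its positive cone $P$ is a submonoid of $A$. For $a\in A$, $P+a=\{x+a\mid x\in P\}$ and $a+P=\{a+x\mid x\in P\}$. A submonoid $M$ of a monoid $A$ is right normal if $a+M\subseteq M+a$ for every $a\in A$. *)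

theory Defs
  imports Main
begin

text \<open>
  Monoids are additive and not assumed commutative, so the preorder is added to the class
  \<open>monoid_add\<close>; the library's ordered additive classes are all commutative and antisymmetric.
\<close>

class preordered_monoid_add = monoid_add + preorder +
  assumes preordered_add_mono: "a \<le> b \<Longrightarrow> c \<le> d \<Longrightarrow> a + c \<le> b + d"

definition positive_cone :: "'a::preordered_monoid_add set"
  where "positive_cone = {a. 0 \<le> a}"

definition left_coset :: "'a::monoid_add \<Rightarrow> 'a set \<Rightarrow> 'a set"
  where "left_coset a M = {a + x | x. x \<in> M}"

definition right_coset :: "'a::monoid_add set \<Rightarrow> 'a \<Rightarrow> 'a set"
  where "right_coset M a = {x + a | x. x \<in> M}"

definition add_submonoid :: "'a::monoid_add set \<Rightarrow> bool"
  where "add_submonoid M \<longleftrightarrow> 0 \<in> M \<and> (\<forall>x\<in>M. \<forall>y\<in>M. x + y \<in> M)"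

definition right_normal_submonoid :: "'a::monoid_add set \<Rightarrow> bool"
  where "right_normal_submonoid M \<longleftrightarrow>
    add_submonoid M \<and> (\<forall>a. left_coset a M \<subseteq> right_coset M a)"

definition cone_le :: "'a::preordered_monoid_add \<Rightarrow> 'a \<Rightarrow> bool"  (infix "\<le>\<^sub>P" 50)
  where "a \<le>\<^sub>P b \<longleftrightarrow> b \<in> right_coset positive_cone a"

end

theory Submission
  imports Defs
begin

text \<open>Right normality of the cone says that a positive element on the right of any
  \<open>a\<close> can be moved to its left, at the price of replacing it by another positive
  element. Monotonicity of addition forces this exchange when \<open>a \<le>\<^sub>P a\<close> and
  \<open>0 \<le>\<^sub>P y\<close> are added. Conversely, in \<open>x + a + y + c\<close> the
  exchange carries \<open>y\<close> past \<open>a\<close>, so that all positive summands stand to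
  the left of \<open>a + c\<close>.\<close>

lemma cone_le_iff: "a \<le>\<^sub>P b \<longleftrightarrow> (\<exists>x\<ge>0. b = x + a)"
  by (auto simp: cone_le_def right_coset_def positive_cone_def)

lemma add_submonoid_positive_cone:
  "add_submonoid (positive_cone :: 'a::preordered_monoid_add set)"
  using preordered_add_mono[of "0::'a" _ 0]
  by (auto simp: add_submonoid_def positive_cone_def)

text \<open>Since the cone is always a submonoid, only the coset inclusion carries content; read
  elementwise, it is the exchange law that both directions of the theorem work with.\<close>

lemma right_normal_positive_cone_iff:
  "right_normal_submonoid (positive_cone :: 'a::preordered_monoid_add set) \<longleftrightarrow>
    (\<forall>a y :: 'a. 0 \<le> y \<longrightarrow> (\<exists>z\<ge>0. a + y = z + a))"
  using add_submonoid_positive_cone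
  by (auto simp: right_normal_submonoid_def left_coset_def right_coset_def
      positive_cone_def subset_iff)

theorem proposition2:
  shows "(\<forall>a b c d :: 'a::preordered_monoid_add.
            a \<le>\<^sub>P b \<and> c \<le>\<^sub>P d \<longrightarrow> a + c \<le>\<^sub>P b + d)
         \<longleftrightarrow> right_normal_submonoid (positive_cone :: 'a set)"
proof
  assume mono: "\<forall>a b c d :: 'a. a \<le>\<^sub>P b \<and> c \<le>\<^sub>P d \<longrightarrow> a + c \<le>\<^sub>P b + d"
  have "\<exists>z\<ge>0. a + y = z + a" if "0 \<le> y" for a y :: 'a
  proof -
    have "a \<le>\<^sub>P a" unfolding cone_le_iff by (rule exI[of _ 0]) simp
    moreover have "0 \<le>\<^sub>P y" unfolding cone_le_iff using that by (intro exI[of _ y]) simp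
    \<comment> \<open>As \<open>a + 0 = a\<close>, the witness of this relation is the required
      \<open>z\<close>.\<close>
    ultimately have "a + 0 \<le>\<^sub>P a + y" using mono by blast
    then show ?thesis by (simp add: cone_le_iff)
  qed
  then show "right_normal_submonoid (positive_cone :: 'a set)"
    by (simp add: right_normal_positive_cone_iff)
next
  assume normal: "right_normal_submonoid (positive_cone :: 'a set)"
  show "\<forall>a b c d :: 'a. a \<le>\<^sub>P b \<and> c \<le>\<^sub>P d \<longrightarrow> a + c \<le>\<^sub>P b + d"
  proof (intro allI impI)
    fix a b c d :: 'a
    assume "a \<le>\<^sub>P b \<and> c \<le>\<^sub>P d"
    then obtain x y where x: "0 \<le> x" "b = x + a" and y: "0 \<le> y" "d = y + c"
      by (auto simp: cone_le_iff)
    \<comment> \<open>Only \<open>y\<close> has to cross \<open>a\<close>, because \<open>x\<close>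
      is already leftmost in \<open>x + a + y + c\<close>.\<close>
    obtain z where z: "0 \<le> z" "a + y = z + a"
      using normal y(1) by (auto simp: right_normal_positive_cone_iff)
    have "b + d = x + (a + y) + c" by (simp add: x y add.assoc)
    also have "\<dots> = (x + z) + (a + c)" by (simp add: z add.assoc)
    finally have "b + d = (x + z) + (a + c)" .
    moreover have "0 \<le> x + z" using preordered_add_mono[OF x(1) z(1)] by simp
    ultimately show "a + c \<le>\<^sub>P b + d" by (auto simp: cone_le_iff)
  qed
qed

end
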